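(* Let $n\geq 2$ and let $j$ be an integer with $2\leq j\leq n$. Then there exist two subgraphs of the augmented cube $AQ_n$, each isomorphic to the hypercube $Q_n$, whose edge sets intersect exactly in $E_j$; and there exist two subgraphs of $AQ_n$, each isomorphic to $Q_n$, whose edge sets intersect exactly in $E_{\leq j}$.
   Context: The hypercube $Q_n$ has vertex set $\{0,1\}^n$, two vertices adjacent iff they differ in exactly one bit. The augmented cube $AQ_n$ has vertex set $\{0,1\}^n$ (strings $x_n\cdots x_1$) and edge set $\left(\bigcup_{i=1}^n E_i\right)\cup\left(\bigcup_{j=2}^n E_{\leq j}\right)$, where $E_i=\{(x_n\cdots x_1,\ x_n\cdots x_{i+1}(x_i+1)x_{i-1}\cdots x_1)\}$ (hypercube edges of dimension $i$: flip bit $i$) and $E_{\leq j}=\{(x_n\cdots x_1,\ x_n\cdots x_{j+1}(x_j+1)\cdots(x_1+1))\}$ (augmented edges of dimension $j$: flip bits $1,\dots,j$), addition mod 2. *)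

theory Defs
  imports
    "Graph_Theory.Pair_Digraph"
    "Graph_Theory.Digraph_Isomorphism"
    "HOL-Library.FuncSet"
    "HOL-Library.Z2"
begin

text \<open>
  A simple graph is a \<^locale>\<open>pair_graph\<close>: a finite irreflexive digraph whose arc set is
  symmetric, so that the undirected edge $uv$ is the pair of arcs $(u,v)$ and $(v,u)$.

  The string $x_n \cdots x_1$ is the function sending the position $i \in \{1,\dots,n\}$ to the
  bit $x_i$; \<^typ>\<open>bit\<close> is the field with two elements, so addition of bits is modulo 2.
\<close>

definition bitstrings :: "nat \<Rightarrow> (nat \<Rightarrow> bit) set" where
  "bitstrings n = {1..n} \<rightarrow>\<^sub>E UNIV"

definition hypercube :: "nat \<Rightarrow> (nat \<Rightarrow> bit) pair_pre_digraph" where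
  "hypercube n = \<lparr> pverts = bitstrings n,
     parcs = {(x, y). x \<in> bitstrings n \<and> y \<in> bitstrings n \<and>
                card {i \<in> {1..n}. x i \<noteq> y i} = 1} \<rparr>"

definition hypercube_edges :: "nat \<Rightarrow> nat \<Rightarrow> ((nat \<Rightarrow> bit) \<times> (nat \<Rightarrow> bit)) set" where
  "hypercube_edges n i = {(x, x(i := x i + 1)) | x. x \<in> bitstrings n}"

definition augmented_edges :: "nat \<Rightarrow> nat \<Rightarrow> ((nat \<Rightarrow> bit) \<times> (nat \<Rightarrow> bit)) set" where
  "augmented_edges n j =
     {(x, \<lambda>i. if i \<in> {1..j} then x i + 1 else x i) | x. x \<in> bitstrings n}"

definition augmented_cube :: "nat \<Rightarrow> (nat \<Rightarrow> bit) pair_pre_digraph" where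
  "augmented_cube n = \<lparr> pverts = bitstrings n,
     parcs = (\<Union>i\<in>{1..n}. hypercube_edges n i) \<union> (\<Union>j\<in>{2..n}. augmented_edges n j) \<rparr>"

lemma finite_bitstrings: "finite (bitstrings n)"
proof -
  have "(UNIV :: bit set) = {0, 1}"
    using bit_not_zero_iff by blast
  then have "finite (UNIV :: bit set)"
    by (metis finite.emptyI finite.insertI)
  then show ?thesis
    unfolding bitstrings_def by (intro finite_PiE) auto
qed

lemma sym_hypercube_edges: "sym (hypercube_edges n i)"
  if "i \<in> {1..n}"
proof (rule symI)
  fix x y assume "(x, y) \<in> hypercube_edges n i"
  then have x: "x \<in> bitstrings n" and y: "y = x(i := x i + 1)"
    by (auto simp: hypercube_edges_def)
  have "y \<in> bitstrings n"
    using x that by (auto simp: y bitstrings_def PiE_iff extensional_def)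
  moreover have "x = y(i := y i + 1)"
    by (auto simp: y fun_eq_iff add.assoc)
  ultimately show "(y, x) \<in> hypercube_edges n i"
    unfolding hypercube_edges_def by blast
qed

lemma sym_augmented_edges: "sym (augmented_edges n j)"
  if "j \<le> n"
proof (rule symI)
  fix x y assume "(x, y) \<in> augmented_edges n j"
  then have x: "x \<in> bitstrings n" and y: "y = (\<lambda>i. if i \<in> {1..j} then x i + 1 else x i)"
    by (auto simp: augmented_edges_def)
  have "y \<in> bitstrings n"
    using x that by (auto simp: y bitstrings_def PiE_iff extensional_def)
  moreover have "x = (\<lambda>i. if i \<in> {1..j} then y i + 1 else y i)"
    by (auto simp: y fun_eq_iff add.assoc)
  ultimately show "(y, x) \<in> augmented_edges n j"
    unfolding augmented_edges_def by blast
qed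

lemma pair_graph_hypercube: "pair_graph (hypercube n)"
proof -
  let ?Q = "hypercube n"
  have sub: "parcs ?Q \<subseteq> bitstrings n \<times> bitstrings n"
    by (auto simp: hypercube_def)
  have fin: "finite (parcs ?Q)"
    by (rule finite_subset[OF sub]) (simp add: finite_bitstrings)
  have symQ: "sym (parcs ?Q)"
  proof (rule symI)
    fix x y assume xy: "(x, y) \<in> parcs ?Q"
    have "{i \<in> {1..n}. y i \<noteq> x i} = {i \<in> {1..n}. x i \<noteq> y i}"
      by (intro Collect_cong) metis
    with xy show "(y, x) \<in> parcs ?Q"
      unfolding hypercube_def by simp
  qed
  show ?thesis
    using fin sub symQ finite_bitstrings[of n]
    by unfold_locales (auto simp: symmetric_def with_proj_def arcs_ends_def arc_to_ends_def hypercube_def)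
qed

lemma pair_graph_augmented_cube: "pair_graph (augmented_cube n)"
proof -
  let ?A = "augmented_cube n"
  have ne: "x \<noteq> y" if xy: "(x, y) \<in> parcs ?A" for x y
  proof -
    have "\<exists>i. y i = x i + 1"
    proof -
      consider i where "(x, y) \<in> hypercube_edges n i"
        | j where "j \<ge> 2" "(x, y) \<in> augmented_edges n j"
        using xy by (auto simp: augmented_cube_def)
      then show ?thesis
      proof cases
        case 1
        then have "y i = x i + 1" by (auto simp: hypercube_edges_def)
        then show ?thesis by blast
      next
        case 2
        then have "y 1 = x 1 + 1" by (auto simp: augmented_edges_def)
        then show ?thesis by blast
      qed
    qed
    then obtain i where "y i = x i + 1" by blast
    moreover have "b + 1 \<noteq> b" for b :: bit by (cases b) simp_all
    ultimately show ?thesis by metis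
  qed
  have symA: "sym (parcs ?A)"
  proof (rule symI)
    fix x y assume "(x, y) \<in> parcs ?A"
    then consider i where "i \<in> {1..n}" "(x, y) \<in> hypercube_edges n i"
      | j where "j \<in> {2..n}" "(x, y) \<in> augmented_edges n j"
      by (auto simp: augmented_cube_def)
    then show "(y, x) \<in> parcs ?A"
    proof cases
      case 1
      then have "(y, x) \<in> hypercube_edges n i"
        using sym_hypercube_edges[of i n] by (blast dest: symD)
      with 1(1) show ?thesis by (auto simp: augmented_cube_def)
    next
      case 2
      then have "(y, x) \<in> augmented_edges n j"
        using sym_augmented_edges[of j n] by (auto dest: symD)
      with 2(1) show ?thesis by (auto simp: augmented_cube_def)
    qed
  qed
  have "fst ` parcs ?A \<subseteq> bitstrings n"
    by (auto simp: augmented_cube_def hypercube_edges_def augmented_edges_def)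
  then have sub: "parcs ?A \<subseteq> bitstrings n \<times> bitstrings n"
    using symA by (force dest: symD)
  have fin: "finite (parcs ?A)"
    by (rule finite_subset[OF sub]) (simp add: finite_bitstrings)
  have vA: "pverts ?A = bitstrings n" by (simp add: augmented_cube_def)
  show ?thesis
    using fin sub symA ne finite_bitstrings[of n]
    by unfold_locales (auto simp: symmetric_def with_proj_def arcs_ends_def arc_to_ends_def vA)
qed

end

theory Submission
  imports Defs
begin

text \<open>
  Both graphs are Cayley graphs of $\mathbb{F}_2^n$: with $a_i = e_1 + \cdots + e_i$, the generators
  of $AQ_n$ are $e_1 = a_1$, $e_2, \dots, e_n$ and $a_2, \dots, a_n$, and any $n$ of them that form a
  basis span a copy of $Q_n$. The bases $\{a_1, \dots, a_n\}$ and $\{a_j, e_2, \dots, e_n\}$ share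
  exactly $a_j$. Replacing $a_j$ by $e_j = a_j - a_{j-1}$ in the first one gives a basis that shares
  exactly $e_j$ with the second.
\<close>

section \<open>Cayley graphs of F_2^n\<close>

definition flip :: "nat set \<Rightarrow> (nat \<Rightarrow> bit) \<Rightarrow> nat \<Rightarrow> bit" where
  "flip A x = (\<lambda>k. if k \<in> A then x k + 1 else x k)"

text \<open>A set \<open>A\<close> of positions stands for its indicator vector, and
  \<open>flip A\<close> is addition of that vector. The generators form a set, not an indexed
  family, so that two graphs can be intersected through their generators.\<close>

definition cayley :: "nat \<Rightarrow> nat set set \<Rightarrow> (nat \<Rightarrow> bit) pair_pre_digraph" where
  "cayley n \<A> = \<lparr> pverts = bitstrings n,
     parcs = {(x, flip A x) | x A. x \<in> bitstrings n \<and> A \<in> \<A>} \<rparr>"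

lemma bit_add_1_neq: "b + 1 \<noteq> (b :: bit)"
  by (cases b) simp_all

lemma bit_neq_iff: "a \<noteq> b \<longleftrightarrow> b = a + 1" for a b :: bit
  by (cases a; cases b) simp_all

text \<open>\<open>A\<close> is recovered as the set of positions where \<open>x\<close> and
  \<open>flip A x\<close> differ, so an arc determines its generator. This reduces intersecting arc
  sets to intersecting generator sets.\<close>

lemma flip_inject [simp]: "flip A x = flip B x \<longleftrightarrow> A = B"
proof
  assume eq: "flip A x = flip B x"
  have "k \<in> A \<longleftrightarrow> k \<in> B" for k
    using fun_cong[OF eq, of k] bit_add_1_neq[of "x k"]
    unfolding flip_def by (metis (full_types))
  then show "A = B" by blast
qed simp

lemma flip_bitstrings: "flip A x \<in> bitstrings n" if "x \<in> bitstrings n" "A \<subseteq> {1..n}"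
  using that by (auto simp: flip_def bitstrings_def PiE_iff extensional_def)

lemma pverts_cayley [simp]: "pverts (cayley n \<A>) = bitstrings n"
  by (simp add: cayley_def)

lemma parcs_cayley: "parcs (cayley n \<A>) = {(x, flip A x) | x A. x \<in> bitstrings n \<and> A \<in> \<A>}"
  by (simp add: cayley_def)

lemma parcs_cayley_Int: "parcs (cayley n \<A>) \<inter> parcs (cayley n \<B>) = parcs (cayley n (\<A> \<inter> \<B>))"
  by (auto simp: parcs_cayley)

section \<open>The edge classes and both cubes as Cayley graphs\<close>

lemma hypercube_edges_conv: "hypercube_edges n i = parcs (cayley n {{i}})"
proof -
  have "x(i := x i + 1) = flip {i} x" for x
    by (auto simp: flip_def)
  then show ?thesis
    by (simp only: hypercube_edges_def parcs_cayley) blast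
qed

lemma augmented_edges_conv: "augmented_edges n j = parcs (cayley n {{1..j}})"
  by (simp only: augmented_edges_def parcs_cayley flip_def) blast

lemma hypercube_conv: "hypercube n = cayley n ((\<lambda>i. {i}) ` {1..n})"
proof -
  have *: "y \<in> bitstrings n \<and> card {i \<in> {1..n}. x i \<noteq> y i} = 1 \<longleftrightarrow> (\<exists>i\<in>{1..n}. y = flip {i} x)"
    (is "?L \<longleftrightarrow> ?R") if x: "x \<in> bitstrings n" for x y
  proof
    assume L: ?L
    then obtain i where i: "{i \<in> {1..n}. x i \<noteq> y i} = {i}"
      by (auto simp: card_1_singleton_iff)
    then have i_n: "i \<in> {1..n}" by blast
    have "y k = flip {i} x k" for k
    proof (cases "k \<in> {1..n}")
      case True
      then have "x k \<noteq> y k \<longleftrightarrow> k = i"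
        using i by blast
      then show ?thesis
        unfolding flip_def by (metis bit_neq_iff singleton_iff)
    next
      case False
      \<comment> \<open>Outside \<open>{1..n}\<close> both strings have the default value, which
        flipping the position \<open>i\<close> leaves alone.\<close>
      then have "x k = undefined" "y k = undefined" "k \<notin> {i}"
        using x L i_n unfolding bitstrings_def by auto
      then show ?thesis
        by (simp add: flip_def)
    qed
    with i_n show ?R by blast
  next
    assume ?R
    then obtain i where i: "i \<in> {1..n}" and y: "y = flip {i} x" by blast
    have "{k \<in> {1..n}. x k \<noteq> y k} = {i}"
      using i bit_add_1_neq unfolding y flip_def by (auto simp del: add_bit_eq_xor split: if_splits)
    then show ?L
      using flip_bitstrings[OF x] i y by simp
  qed
  have "(x, y) \<in> parcs (hypercube n) \<longleftrightarrow> (x, y) \<in> parcs (cayley n ((\<lambda>i. {i}) ` {1..n}))" for x y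
  proof -
    have "(x, y) \<in> parcs (hypercube n) \<longleftrightarrow>
        x \<in> bitstrings n \<and> y \<in> bitstrings n \<and> card {i \<in> {1..n}. x i \<noteq> y i} = 1"
      by (simp add: hypercube_def)
    also have "\<dots> \<longleftrightarrow> x \<in> bitstrings n \<and> (\<exists>i\<in>{1..n}. y = flip {i} x)"
      using *[of x y] by (rule conj_cong[OF refl])
    also have "\<dots> \<longleftrightarrow> (x, y) \<in> parcs (cayley n ((\<lambda>i. {i}) ` {1..n}))"
      by (auto simp: parcs_cayley)
    finally show ?thesis .
  qed
  then have arcs: "parcs (hypercube n) = parcs (cayley n ((\<lambda>i. {i}) ` {1..n}))"
    by (simp add: set_eq_iff del: One_nat_def)
  have "pverts (hypercube n) = pverts (cayley n ((\<lambda>i. {i}) ` {1..n}))"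
    by (simp add: hypercube_def)
  then show ?thesis
    by (rule pair_pre_digraph.equality) (rule arcs, simp)
qed

lemma augmented_cube_conv:
  "augmented_cube n = cayley n ((\<lambda>i. {i}) ` {1..n} \<union> (\<lambda>j. {1..j}) ` {2..n})"
  unfolding augmented_cube_def hypercube_edges_conv augmented_edges_conv
  by (auto simp: cayley_def)

section \<open>Subgraphs and change of basis\<close>

lemma wf_digraph_cayley: "wf_digraph (with_proj (cayley n \<A>))" if "\<And>A. A \<in> \<A> \<Longrightarrow> A \<subseteq> {1..n}"
proof
  fix e assume "e \<in> arcs (with_proj (cayley n \<A>))"
  then obtain x A where "x \<in> bitstrings n" "A \<in> \<A>" "e = (x, flip A x)"
    by (auto simp: parcs_cayley)
  then show "tail (with_proj (cayley n \<A>)) e \<in> verts (with_proj (cayley n \<A>))"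
    "head (with_proj (cayley n \<A>)) e \<in> verts (with_proj (cayley n \<A>))"
    using flip_bitstrings that by simp_all
qed

lemma subgraph_cayley:
  assumes "\<A> \<subseteq> \<B>" "\<And>B. B \<in> \<B> \<Longrightarrow> B \<subseteq> {1..n}"
  shows "subgraph (with_proj (cayley n \<A>)) (with_proj (cayley n \<B>))"
  using assms wf_digraph_cayley[of \<A> n] wf_digraph_cayley[of \<B> n]
  by (auto simp: subgraph_def parcs_cayley)

text \<open>
  The rank \<open>r\<close> makes the indicator vectors of the sets \<open>D i\<close> triangular, hence a basis of
  $\mathbb{F}_2^n$, and the isomorphism is the change of basis.
\<close>

lemma cayley_iso_hypercube:
  fixes D :: "nat \<Rightarrow> nat set" and r :: "nat \<Rightarrow> nat"
  assumes sub: "\<And>i. i \<in> {1..n} \<Longrightarrow> D i \<subseteq> {1..n}"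
    and diag: "\<And>i. i \<in> {1..n} \<Longrightarrow> i \<in> D i"
    and less: "\<And>i k. i \<in> {1..n} \<Longrightarrow> k \<in> D i \<Longrightarrow> k \<noteq> i \<Longrightarrow> r k < r i"
  shows "digraph_iso (with_proj (cayley n (D ` {1..n}))) (with_proj (hypercube n))"
proof -
  \<comment> \<open>\<open>g\<close> is the linear map sending e_i to the indicator vector of
    \<open>D i\<close>: its coordinate \<open>k\<close> sums \<open>y i\<close> over the sets
    \<open>D i\<close> that contain \<open>k\<close>.\<close>
  define I where "I k = {i \<in> {1..n}. k \<in> D i}" for k
  define g :: "(nat \<Rightarrow> bit) \<Rightarrow> nat \<Rightarrow> bit"
    where "g y = (\<lambda>k. if k \<in> {1..n} then \<Sum>i\<in>I k. y i else undefined)" for y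
  have fin: "finite (I k)" for k
    by (simp add: I_def)
  have g_flip: "g (flip {i} y) = flip (D i) (g y)" if i: "i \<in> {1..n}" for i y
  proof
    fix k
    show "g (flip {i} y) k = flip (D i) (g y) k"
    proof (cases "k \<in> D i")
      case True
      then have k: "k \<in> {1..n}" and iI: "i \<in> I k"
        using sub[OF i] i by (auto simp: I_def)
      have "(\<Sum>l\<in>I k - {i}. flip {i} y l) = (\<Sum>l\<in>I k - {i}. y l)"
        by (intro sum.cong) (auto simp: flip_def)
      then have "(\<Sum>l\<in>I k. flip {i} y l) = (\<Sum>l\<in>I k. y l) + 1"
        unfolding sum.remove[OF fin iI] by (simp add: flip_def ac_simps del: add_bit_eq_xor)
      then show ?thesis
        using k True by (simp add: g_def flip_def)
    next
      case False
      then have "(\<Sum>l\<in>I k. flip {i} y l) = (\<Sum>l\<in>I k. y l)"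
        by (intro sum.cong) (auto simp: flip_def I_def)
      then show ?thesis
        using False by (simp add: g_def flip_def)
    qed
  qed
  have inj: "inj_on g (bitstrings n)"
  proof (rule inj_onI, rule ccontr)
    fix x y
    assume x: "x \<in> bitstrings n" and y: "y \<in> bitstrings n" and eq: "g x = g y" and "x \<noteq> y"
    define S where "S = {i \<in> {1..n}. x i \<noteq> y i}"
    obtain k where k: "x k \<noteq> y k"
      using \<open>x \<noteq> y\<close> by auto
    then have "k \<in> {1..n}"
      using x y unfolding bitstrings_def by (metis PiE_arb)
    with k have "k \<in> S" by (simp add: S_def)
    moreover have "finite S" by (simp add: S_def)
    \<comment> \<open>Take a differing position \<open>i\<close> of maximal rank. Any other
      \<open>D l\<close> containing \<open>i\<close> has \<open>r i < r l\<close>, so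
      \<open>x\<close> and \<open>y\<close> agree at \<open>l\<close>. Comparing coordinate
      \<open>i\<close> of \<open>g x\<close> and \<open>g y\<close> then forces
      \<open>x i = y i\<close>.\<close>
    ultimately obtain i where i: "i \<in> S" and max: "\<And>l. l \<in> S \<Longrightarrow> r l \<le> r i"
      using Max_in[of "r ` S"] Max_ge[of "r ` S"] by fastforce
    have n: "i \<in> {1..n}" and iI: "i \<in> I i"
      using i diag by (auto simp: S_def I_def)
    have "(\<Sum>l\<in>I i - {i}. x l) = (\<Sum>l\<in>I i - {i}. y l)"
    proof (rule sum.cong)
      fix l assume "l \<in> I i - {i}"
      then have "l \<in> {1..n}" "r i < r l"
        using less[of l i] by (auto simp: I_def)
      then show "x l = y l"
        using max[of l] by (auto simp: S_def)
    qed simp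
    moreover have "(\<Sum>l\<in>I i. x l) = (\<Sum>l\<in>I i. y l)"
      using fun_cong[OF eq, of i] n by (simp add: g_def)
    ultimately have "x i = y i"
      unfolding sum.remove[OF fin iI] by (simp del: add_bit_eq_xor)
    with i show False by (simp add: S_def)
  qed
  have "g ` bitstrings n \<subseteq> bitstrings n"
    by (auto simp: g_def bitstrings_def)
  then have surj: "g ` bitstrings n = bitstrings n"
    using inj by (intro endo_inj_surj finite_bitstrings)
  \<comment> \<open>Arcs are pairs of vertices, so the arc map is induced by \<open>g\<close>, and
    head and tail remain the projections.\<close>
  define h where "h = \<lparr> iso_verts = g, iso_arcs = map_prod g g, iso_head = snd, iso_tail = fst \<rparr>"
  let ?Q = "with_proj (cayley n ((\<lambda>i. {i}) ` {1..n}))"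
  have wf: "wf_digraph ?Q"
    by (rule wf_digraph_cayley) auto
  have "parcs (cayley n ((\<lambda>i. {i}) ` {1..n})) \<subseteq> bitstrings n \<times> bitstrings n"
    using wf_digraph.head_in_verts[OF wf] wf_digraph.tail_in_verts[OF wf] by force
  then have "inj_on (map_prod g g) (parcs (cayley n ((\<lambda>i. {i}) ` {1..n})))"
    using map_prod_inj_on[OF inj inj] inj_on_subset by blast
  then have "pre_digraph.digraph_isomorphism ?Q h"
    unfolding pre_digraph.digraph_isomorphism_def using wf inj by (simp add: h_def)
  moreover have "map_prod g g ` parcs (cayley n ((\<lambda>i. {i}) ` {1..n})) = parcs (cayley n (D ` {1..n}))"
  proof -
    have arcs: "parcs (cayley n (F ` {1..n})) = (\<Union>i\<in>{1..n}. (\<lambda>x. (x, flip (F i) x)) ` bitstrings n)" for F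
      by (auto simp: parcs_cayley)
    have "map_prod g g ` parcs (cayley n ((\<lambda>i. {i}) ` {1..n})) =
        (\<Union>i\<in>{1..n}. (\<lambda>x. (g x, g (flip {i} x))) ` bitstrings n)"
      unfolding arcs image_UN image_image map_prod_simp ..
    also have "\<dots> = (\<Union>i\<in>{1..n}. (\<lambda>x. (x, flip (D i) x)) ` g ` bitstrings n)"
      by (simp add: g_flip image_image)
    also have "\<dots> = parcs (cayley n (D ` {1..n}))"
      unfolding surj arcs ..
    finally show ?thesis .
  qed
  then have "with_proj (cayley n (D ` {1..n})) = app_iso h ?Q"
    using surj by (simp add: app_iso_def h_def with_proj_def)
  ultimately have "digraph_iso ?Q (with_proj (cayley n (D ` {1..n})))"
    unfolding digraph_iso_def by blast
  then show ?thesis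
    unfolding hypercube_conv by (rule digraph_iso_swap[OF wf])
qed

theorem theorem3p4:
  fixes n j :: nat
  assumes "n \<ge> 2" and "2 \<le> j" and "j \<le> n"
  shows "(\<exists>H\<^sub>1 H\<^sub>2 :: (nat \<Rightarrow> bit) pair_pre_digraph.
            H\<^sub>1 \<noteq> H\<^sub>2 \<and>
            subgraph (with_proj H\<^sub>1) (with_proj (augmented_cube n)) \<and>
            subgraph (with_proj H\<^sub>2) (with_proj (augmented_cube n)) \<and>
            digraph_iso (with_proj H\<^sub>1) (with_proj (hypercube n)) \<and>
            digraph_iso (with_proj H\<^sub>2) (with_proj (hypercube n)) \<and>
            parcs H\<^sub>1 \<inter> parcs H\<^sub>2 = hypercube_edges n j) \<and>
         (\<exists>H\<^sub>1 H\<^sub>2 :: (nat \<Rightarrow> bit) pair_pre_digraph.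
            H\<^sub>1 \<noteq> H\<^sub>2 \<and>
            subgraph (with_proj H\<^sub>1) (with_proj (augmented_cube n)) \<and>
            subgraph (with_proj H\<^sub>2) (with_proj (augmented_cube n)) \<and>
            digraph_iso (with_proj H\<^sub>1) (with_proj (hypercube n)) \<and>
            digraph_iso (with_proj H\<^sub>2) (with_proj (hypercube n)) \<and>
            parcs H\<^sub>1 \<inter> parcs H\<^sub>2 = augmented_edges n j)"
proof -
  \<comment> \<open>Each family is indexed so that the set with index \<open>i\<close> contains
    \<open>i\<close>, as \<open>cayley_iso_hypercube\<close> demands. In \<open>\<B>\<close> the
    vector a_j therefore takes the place of e_1.\<close>
  define \<A> where "\<A> = (\<lambda>i. {1..i}) ` {1..n}"
  define \<A>' where "\<A>' = (\<lambda>i. if i = j then {j} else {1..i}) ` {1..n}"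
  define \<B> where "\<B> = (\<lambda>i. if i = 1 then {1..j} else {i}) ` {1..n}"
  let ?G = "(\<lambda>i. {i}) ` {1..n} \<union> (\<lambda>j. {1..j}) ` {2..n}"
  have j: "{1..j} \<noteq> {i}" for i
    using assms by (metis atLeastAtMost_singleton_iff numeral_le_one_iff semiring_norm(69))
  have seg: "{1..i} \<in> ?G" if "i \<in> {1..n}" for i
  proof (cases "i = 1")
    case True
    then have "{1..i} = {i}" by simp
    then show ?thesis using that by blast
  next
    case False
    then show ?thesis using that by auto
  qed
  have "j \<in> {1..n}"
    using assms by simp
  then have sub: "\<A> \<subseteq> ?G" "\<A>' \<subseteq> ?G" "\<B> \<subseteq> ?G"
    unfolding \<A>_def \<A>'_def \<B>_def using seg by (intro image_subsetI; simp split: if_splits; fail)+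
  have sub': "subgraph (with_proj (cayley n \<C>)) (with_proj (augmented_cube n))"
    if "\<C> \<subseteq> ?G" for \<C>
    unfolding augmented_cube_conv by (rule subgraph_cayley[OF that]) auto
  have iso: "digraph_iso (with_proj (cayley n \<A>)) (with_proj (hypercube n))"
    unfolding \<A>_def by (rule cayley_iso_hypercube[where r = id]) auto
  have iso': "digraph_iso (with_proj (cayley n \<A>')) (with_proj (hypercube n))"
    unfolding \<A>'_def by (rule cayley_iso_hypercube[where r = id]) (auto split: if_splits)
  have isoB: "digraph_iso (with_proj (cayley n \<B>)) (with_proj (hypercube n))"
    unfolding \<B>_def using assms
    \<comment> \<open>Only the set with index 1 has elements other than its index, so ranking 1
      above all other positions suffices.\<close>
    by (intro cayley_iso_hypercube[where r = "\<lambda>i. if i = 1 then 1 else 0"]) (auto split: if_splits)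
  \<comment> \<open>A nonempty initial segment contains 1, so it is no singleton of another
    position.\<close>
  have seg_single: "{1..i} \<noteq> {k}" if "k \<noteq> 1" "i \<in> {1..n}" for i k :: nat
    using that by (metis atLeastAtMost_iff atLeastAtMost_singleton_iff order_refl singletonD)
  have seg_inj: "{1..i} = {1..k} \<longleftrightarrow> i = k" if "i \<in> {1..n}" for i k :: nat
    using that by auto
  have inter: "\<A> \<inter> \<B> = {{1..j}}"
    using assms seg_single by (fastforce simp: \<A>_def \<B>_def)
  have inter': "\<A>' \<inter> \<B> = {{j}}"
  proof
    show "\<A>' \<inter> \<B> \<subseteq> {{j}}"
    proof
      fix A assume "A \<in> \<A>' \<inter> \<B>"
      then obtain i k where "i \<in> {1..n}" "A = (if i = j then {j} else {1..i})"
        "A = (if k = 1 then {1..j} else {k})"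
        unfolding \<A>'_def \<B>_def by blast
      \<comment> \<open>If \<open>i\<close> differs from \<open>j\<close>, then
        \<open>{1..i}\<close> is neither \<open>{1..j}\<close> nor a singleton \<open>{k}\<close>
        with \<open>k\<close> different from 1. Only \<open>{j}\<close> remains.\<close>
      then show "A \<in> {{j}}"
        using seg_single[of k i] seg_inj[of i j] by (metis singletonI)
    qed
    show "{{j}} \<subseteq> \<A>' \<inter> \<B>"
      using assms by (auto simp: \<A>'_def \<B>_def image_iff intro: bexI[of _ j])
  qed
  \<comment> \<open>The arcs leaving a single vertex determine the generator set; the zero string
    provides a vertex.\<close>
  have neq: "cayley n \<C> \<noteq> cayley n \<D>" if "\<C> \<noteq> \<D>" for \<C> \<D>
  proof
    have "(\<lambda>i. if i \<in> {1..n} then 0 else undefined) \<in> bitstrings n"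
      by (auto simp: bitstrings_def)
    then obtain x where x: "x \<in> bitstrings n" by blast
    assume "cayley n \<C> = cayley n \<D>"
    then have "(x, flip A x) \<in> parcs (cayley n \<C>) \<longleftrightarrow> (x, flip A x) \<in> parcs (cayley n \<D>)" for A
      by simp
    then show False
      using x that by (auto simp: parcs_cayley)
  qed
  \<comment> \<open>The generator e_1 = a_1 separates the graphs: it survives in
    \<open>\<A>'\<close> because \<open>j\<close> is not 1, while \<open>\<B>\<close> has a_j
    instead.\<close>
  have "{1} \<in> \<A>" "{1} \<in> \<A>'"
    using assms unfolding \<A>_def \<A>'_def by (intro image_eqI[where x = 1]; simp)+
  moreover have "{1} \<notin> \<B>"
  proof
    assume "{1} \<in> \<B>"
    then obtain k where "{1} = (if k = 1 then {1..j} else {k})"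
      unfolding \<B>_def by blast
    then show False
      using j[of 1] by (cases "k = 1") auto
  qed
  ultimately have "cayley n \<A> \<noteq> cayley n \<B>" "cayley n \<A>' \<noteq> cayley n \<B>"
    by (metis neq)+
  then show ?thesis
    unfolding hypercube_edges_conv augmented_edges_conv inter[symmetric] inter'[symmetric]
      parcs_cayley_Int[symmetric]
    using sub[THEN sub'] iso iso' isoB by blast
qed

end
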